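(* Let $\mathbb{F}$ be a field and $t\ge 1$. All nonzero multiples $g\cdot x_1\cdots x_n\in\mathbb{F}[x_1,\ldots,x_n]$ of the monomial $x_1\cdots x_n$ of degree $<\mathrm{char}(\mathbb{F})$ require size $\ge\exp(\Omega(n/t))$ to be computed as a $\sum\bigwedge\sum\prod^{t}$ formula.
   Context: A $\sum\bigwedge\sum\prod^{t}$ formula in $x_1,\ldots,x_n$ is an expression $\sum_{i=1}^sf_i(\overline{x})^{d_i}$ with $f_i\in\mathbb{F}[\overline{x}]$ of degree at most $t$; its size is $\binom{n+t}{t}\cdot\sum_{i=1}^s(d_i+1)$. Convention: in characteristic zero the condition "degree $<\mathrm{char}(\mathbb{F})$" is vacuous (all nonzero multiples are covered). The constant in $\Omega$ is absolute and positive. *)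

theory Defs
  imports Complex_Main "HOL-Library.Poly_Mapping" "HOL-Computational_Algebra.Computational_Algebra"
begin

text \<open>Polynomials in the variables \<open>x\<^sub>0, x\<^sub>1, x\<^sub>2, \<dots>\<close>: finitely supported maps from exponent vectors
  to coefficients, with the ring structure of \<^theory>\<open>HOL-Library.Poly_Mapping\<close>.\<close>

type_synonym 'a mpoly = "(nat \<Rightarrow>\<^sub>0 nat) \<Rightarrow>\<^sub>0 'a"

definition poly_ring :: "nat \<Rightarrow> 'a::zero mpoly set"
  where "poly_ring n = {p. \<forall>m\<in>Poly_Mapping.keys p. Poly_Mapping.keys m \<subseteq> {1..n}}"

definition mono_deg :: "(nat \<Rightarrow>\<^sub>0 nat) \<Rightarrow> nat"
  where "mono_deg m = (\<Sum>i\<in>Poly_Mapping.keys m. Poly_Mapping.lookup m i)"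

text \<open>The zero polynomial gets degree 0, so it satisfies every bound ``degree at most \<open>t\<close>''.\<close>

definition total_degree :: "'a::zero mpoly \<Rightarrow> nat"
  where "total_degree p = Max (insert 0 (mono_deg ` Poly_Mapping.keys p))"

definition indet :: "nat \<Rightarrow> 'a::{zero,one} mpoly"
  where "indet i = Poly_Mapping.single (Poly_Mapping.single i 1) 1"

text \<open>The expression \<open>f\<^sub>1^d\<^sub>1 + \<dots> + f\<^sub>s^d\<^sub>s\<close> is the list \<open>[(f\<^sub>1, d\<^sub>1), \<dots>, (f\<^sub>s, d\<^sub>s)]\<close>. It is syntax:
  a polynomial has many such expressions, and the size belongs to the expression.\<close>

type_synonym 'a power_sum = "('a mpoly \<times> nat) list"

definition power_sum_formula :: "nat \<Rightarrow> nat \<Rightarrow> 'a::zero power_sum \<Rightarrow> bool"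
  where "power_sum_formula n t \<Phi> \<longleftrightarrow> (\<forall>(f, d)\<in>set \<Phi>. f \<in> poly_ring n \<and> total_degree f \<le> t)"

definition formula_poly :: "'a::comm_semiring_1 power_sum \<Rightarrow> 'a mpoly"
  where "formula_poly \<Phi> = (\<Sum>(f, d)\<leftarrow>\<Phi>. f ^ d)"

definition formula_size :: "nat \<Rightarrow> nat \<Rightarrow> 'a power_sum \<Rightarrow> nat"
  where "formula_size n t \<Phi> = ((n + t) choose t) * (\<Sum>(f, d)\<leftarrow>\<Phi>. d + 1)"

text \<open>The constant hidden in \<open>exp (\<Omega>(n/t))\<close>. It must not depend on the field. An existential quantifier
  in a HOL formula cannot range outside the type variable for the field, so \<open>\<exists>c > 0\<close> would
  allow a different \<open>c\<close> for every field; a fixed number expresses an absolute constant. Its value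
  has no significance and is not optimal.\<close>

definition exponent_const :: real
  where "exponent_const = 1 / 100"

end

theory Submission
  imports Defs
begin

text \<open>
  The proof is the method of shifted partial derivatives. A derivative of order \<open>k\<close> of \<open>f\<^sup>d\<close> with
  \<open>deg f \<le> t\<close> is \<open>f\<close> to the power \<open>d - k\<close> times a polynomial of degree at most \<open>k (t - 1)\<close>. Hence
  the products of monomials of degree at most \<open>L\<close> with \<open>k\<close>-th order derivatives of a sum of \<open>s\<close>
  powers span a space of dimension at most \<open>s\<close> times the number of monomials of degree at most
  \<open>L + k (t - 1)\<close>. On the other hand, every exponent of a multiple of \<open>x\<^sub>1 \<dots> x\<^sub>n\<close> is positive and,
  by the degree bound, nonzero in the field, so for \<open>|B| = k\<close> the derivative along \<open>B\<close> turns the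
  leading exponent \<open>A\<close> into \<open>A - 1\<^sub>B\<close>. The shifted derivatives therefore have at least as many
  leading monomials as there are exponents \<open>1 - 1\<^sub>B + c\<close> with \<open>|c| \<le> L\<close>, and leading monomials are
  linearly independent. With \<open>L = n t\<close> and \<open>k = \<lfloor>n / (20 t)\<rfloor>\<close> this forces \<open>s \<ge> 2\<^sup>k\<close>.
\<close>

subsection \<open>Exponents and monomials\<close>

lemma poly_mapping_sum_single:
  "p = (\<Sum>m\<in>Poly_Mapping.keys p. Poly_Mapping.single m (Poly_Mapping.lookup p m))"
  by (rule poly_mapping_eqI)
    (simp add: lookup_sum lookup_single when_def in_keys_iff)

lemma lookup_single_mult_add:
  fixes p :: "'a::comm_semiring_1 mpoly"
  shows "Poly_Mapping.lookup (Poly_Mapping.single c 1 * p) (c + m) = Poly_Mapping.lookup p m"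
proof -
  have "Poly_Mapping.single c 1 * p
      = (\<Sum>k\<in>Poly_Mapping.keys p. Poly_Mapping.single (c + k) (Poly_Mapping.lookup p k))"
    by (subst poly_mapping_sum_single[of p]) (simp add: sum_distrib_left mult_single)
  then show ?thesis
    by (simp add: lookup_sum lookup_single when_def in_keys_iff)
qed

lemma keys_add_nat:
  fixes a b :: "'b \<Rightarrow>\<^sub>0 nat"
  shows "Poly_Mapping.keys (a + b) = Poly_Mapping.keys a \<union> Poly_Mapping.keys b"
  by (auto simp: in_keys_iff lookup_add)

lemma keys_monomial_mult:
  fixes p :: "'a::comm_semiring_1 mpoly"
  shows "Poly_Mapping.keys (Poly_Mapping.single c 1 * p) \<subseteq> (+) c ` Poly_Mapping.keys p"
  using keys_mult[of "Poly_Mapping.single c 1" p] by (auto simp: image_iff split: if_splits)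

lemma mono_deg_superset:
  assumes "finite S" "Poly_Mapping.keys m \<subseteq> S"
  shows "mono_deg m = (\<Sum>i\<in>S. Poly_Mapping.lookup m i)"
  unfolding mono_deg_def using assms by (intro sum.mono_neutral_left) (auto simp: in_keys_iff)

lemma mono_deg_add: "mono_deg (a + b) = mono_deg a + mono_deg b"
  using mono_deg_superset[of "Poly_Mapping.keys a \<union> Poly_Mapping.keys b" a]
    mono_deg_superset[of "Poly_Mapping.keys a \<union> Poly_Mapping.keys b" b]
    mono_deg_superset[of "Poly_Mapping.keys a \<union> Poly_Mapping.keys b" "a + b"]
  by (simp add: keys_add_nat lookup_add sum.distrib)

lemma mono_deg_single: "mono_deg (Poly_Mapping.single i d) = d"
  by (simp add: mono_deg_def)

lemma lookup_le_mono_deg: "Poly_Mapping.lookup m i \<le> mono_deg m"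
  by (cases "i \<in> Poly_Mapping.keys m")
    (auto simp: mono_deg_def in_keys_iff intro: member_le_sum)

lemma mono_deg_le_total_degree: "m \<in> Poly_Mapping.keys p \<Longrightarrow> mono_deg m \<le> total_degree p"
  by (simp add: total_degree_def)

definition set_exp :: "nat set \<Rightarrow> nat \<Rightarrow>\<^sub>0 nat"
  where "set_exp S = (\<Sum>i\<in>S. Poly_Mapping.single i 1)"

lemma lookup_set_exp:
  "finite S \<Longrightarrow> Poly_Mapping.lookup (set_exp S) i = (if i \<in> S then 1 else 0)"
  by (simp add: set_exp_def lookup_sum lookup_single when_def)

lemma keys_set_exp: "finite S \<Longrightarrow> Poly_Mapping.keys (set_exp S) = S"
  by (auto simp: in_keys_iff lookup_set_exp split: if_splits)

lemma prod_indet: "(\<Prod>i\<in>S. indet i) = (Poly_Mapping.single (set_exp S) 1 :: 'a::comm_semiring_1 mpoly)"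
  by (induction S rule: infinite_finite_induct)
    (simp_all add: set_exp_def indet_def mult_single)

definition exps :: "nat set \<Rightarrow> nat \<Rightarrow> (nat \<Rightarrow>\<^sub>0 nat) set"
  where "exps S D = {m. Poly_Mapping.keys m \<subseteq> S \<and> mono_deg m \<le> D}"

lemma exps_mono: "D \<le> E \<Longrightarrow> exps S D \<subseteq> exps S E"
  by (auto simp: exps_def)

lemma exps_add: "a \<in> exps S D \<Longrightarrow> b \<in> exps S E \<Longrightarrow> a + b \<in> exps S (D + E)"
  by (auto simp: exps_def mono_deg_add keys_add_nat)

lemma mono_deg_eq_0_iff: "mono_deg m = 0 \<longleftrightarrow> m = 0"
  by (auto simp: mono_deg_def in_keys_iff intro!: poly_mapping_eqI)

lemma exps_empty: "exps {} D = {0}"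
  by (auto simp: exps_def mono_deg_def)

lemma exps_0: "exps S 0 = {0}"
  by (auto simp: exps_def mono_deg_eq_0_iff)

text \<open>Pascal's rule for exponents: either \<open>x\<close> does not occur, or one factor
  \<open>x\<close> can be split off at the cost of one degree. The count in
  \<open>finite_card_exps\<close> rests on this.\<close>

lemma exps_insert_Suc:
  assumes "x \<notin> S"
  shows "exps (insert x S) (Suc D)
    = exps S (Suc D) \<union> (+) (Poly_Mapping.single x 1) ` exps (insert x S) D" (is "?l = ?r")
proof (intro equalityI subsetI)
  fix m assume m: "m \<in> ?l"
  show "m \<in> ?r"
  proof (cases "x \<in> Poly_Mapping.keys m")
    case True
    define m' where "m' = m - Poly_Mapping.single x 1"
    have eq: "m = Poly_Mapping.single x 1 + m'"
      using True by (intro poly_mapping_eqI) 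
        (auto simp: m'_def lookup_add lookup_minus lookup_single when_def in_keys_iff)
    have "m' \<in> exps (insert x S) D"
      using m unfolding eq by (auto simp: exps_def mono_deg_add mono_deg_single keys_add_nat)
    then show ?thesis using eq by blast
  qed (use m in \<open>auto simp: exps_def\<close>)
qed (auto simp: exps_def mono_deg_add mono_deg_single keys_add_nat)

lemma finite_card_exps:
  "finite S \<Longrightarrow> finite (exps S D) \<and> card (exps S D) = (card S + D) choose D"
proof (induction S arbitrary: D rule: finite_induct)
  case (insert x S)
  show ?case
  proof (induction D)
    case (Suc D)
    have "exps S (Suc D) \<inter> (+) (Poly_Mapping.single x 1) ` exps (insert x S) D = {}"
      using insert.hyps by (auto simp: exps_def keys_add_nat)
    moreover have "card ((+) (Poly_Mapping.single x 1) ` exps (insert x S) D)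
        = card (exps (insert x S) D)"
      by (intro card_image) simp
    ultimately show ?case
      using insert Suc by (simp add: exps_insert_Suc card_Un_disjoint)
  qed (simp add: exps_0)
qed (simp add: exps_empty)

text \<open>Bounding the exponents controls variables and degree at once and puts the zero
  polynomial into every \<open>low S D\<close>, so closure under sums and products needs no case
  distinction.\<close>

definition low :: "nat set \<Rightarrow> nat \<Rightarrow> 'a::zero mpoly set"
  where "low S D = {p. Poly_Mapping.keys p \<subseteq> exps S D}"

lemma low_mono: "D \<le> E \<Longrightarrow> low S D \<subseteq> low S E"
  using exps_mono by (fastforce simp: low_def)

lemma low_add: "p \<in> low S D \<Longrightarrow> q \<in> low S D \<Longrightarrow> p + q \<in> low S D"
  using Poly_Mapping.keys_add[of p q] by (auto simp: low_def)

lemma low_mult: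
  fixes p q :: "'a::comm_semiring_1 mpoly"
  shows "p \<in> low S D \<Longrightarrow> q \<in> low S E \<Longrightarrow> p * q \<in> low S (D + E)"
  unfolding low_def using keys_mult[of p q] exps_add[of _ S D _ E] by fast

lemma low_of_nat: "(of_nat c :: 'a::comm_semiring_1 mpoly) \<in> low S 0"
  unfolding single_of_nat[symmetric] low_def exps_0 by (simp only: keys_single mem_Collect_eq) simp

lemma low_monomial: "m \<in> exps S D \<Longrightarrow> Poly_Mapping.single m c \<in> low S D"
  by (auto simp: low_def)

subsection \<open>Partial derivatives\<close>

text \<open>The formal derivative, given by its coefficients so that those of iterated derivatives
  can be read off. The support stays finite because the shift of exponents is injective.\<close>

lift_definition pderiv_var :: "nat \<Rightarrow> 'a::comm_semiring_1 mpoly \<Rightarrow> 'a mpoly"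
  is "\<lambda>i p m. of_nat (Suc (Poly_Mapping.lookup m i)) * p (m + Poly_Mapping.single i 1)"
proof -
  fix i :: nat and p :: "(nat \<Rightarrow>\<^sub>0 nat) \<Rightarrow> 'a"
  assume "finite {m. p m \<noteq> 0}"
  then have "finite ((\<lambda>m. m + Poly_Mapping.single i 1) -` {m. p m \<noteq> 0})"
    by (intro finite_vimageI) (auto intro: injI)
  then show "finite {m. of_nat (Suc (Poly_Mapping.lookup m i)) * p (m + Poly_Mapping.single i 1) \<noteq> 0}"
    by (rule rev_finite_subset) auto
qed

lemma pderiv_var_add: "pderiv_var i (p + q) = pderiv_var i p + pderiv_var i q"
  by (rule poly_mapping_eqI) (simp only: pderiv_var.rep_eq lookup_add distrib_left)

lemma pderiv_var_0 [simp]: "pderiv_var i 0 = 0"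
  by (rule poly_mapping_eqI) (simp add: pderiv_var.rep_eq)

lemma pderiv_var_sum: "pderiv_var i (\<Sum>x\<in>A. f x) = (\<Sum>x\<in>A. pderiv_var i (f x))"
  by (induction A rule: infinite_finite_induct) (simp_all add: pderiv_var_add)

lemma pderiv_var_sum_list: "pderiv_var i (\<Sum>x\<leftarrow>xs. f x) = (\<Sum>x\<leftarrow>xs. pderiv_var i (f x))"
  by (induction xs) (simp_all add: pderiv_var_add)

lemma pderiv_var_single:
  "pderiv_var i (Poly_Mapping.single m c)
    = Poly_Mapping.single (m - Poly_Mapping.single i 1) (of_nat (Poly_Mapping.lookup m i) * c)"
proof (rule poly_mapping_eqI)
  fix k
  have "m = k + Poly_Mapping.single i 1 \<longleftrightarrow> m - Poly_Mapping.single i 1 = k"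
    if "Poly_Mapping.lookup m i \<noteq> 0"
  proof
    assume "m - Poly_Mapping.single i 1 = k"
    then show "m = k + Poly_Mapping.single i 1"
      using that by (auto intro!: poly_mapping_eqI simp: lookup_add lookup_minus lookup_single when_def)
  qed simp
  then show "Poly_Mapping.lookup (pderiv_var i (Poly_Mapping.single m c)) k
    = Poly_Mapping.lookup (Poly_Mapping.single (m - Poly_Mapping.single i 1)
        (of_nat (Poly_Mapping.lookup m i) * c)) k"
    by (cases "Poly_Mapping.lookup m i = 0")
      (auto simp: pderiv_var.rep_eq lookup_single when_def lookup_add lookup_minus simp del: of_nat_Suc)
qed

lemma pderiv_var_mult_single:
  fixes c d :: "'a::comm_semiring_1"
  shows "pderiv_var i (Poly_Mapping.single a c * Poly_Mapping.single b d)
   = pderiv_var i (Poly_Mapping.single a c) * Poly_Mapping.single b d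
     + Poly_Mapping.single a c * pderiv_var i (Poly_Mapping.single b d)"
proof -
  \<comment> \<open>Subtraction of exponents truncates, so the two exponents can differ when
    \<open>i\<close> does not occur in \<open>a\<close>; the coefficient is then zero.\<close>
  have shift: "Poly_Mapping.single (a - Poly_Mapping.single i 1 + b) (of_nat (Poly_Mapping.lookup a i) * x)
      = Poly_Mapping.single (a + b - Poly_Mapping.single i 1) (of_nat (Poly_Mapping.lookup a i) * x)"
    for a b :: "nat \<Rightarrow>\<^sub>0 nat" and x :: 'a
  proof (cases "Poly_Mapping.lookup a i = 0")
    case False
    then have "a - Poly_Mapping.single i 1 + b = a + b - Poly_Mapping.single i 1"
      by (intro poly_mapping_eqI) (auto simp: lookup_add lookup_minus lookup_single when_def)
    then show ?thesis by simp
  qed simp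
  show ?thesis
    using shift[of a b "c * d"] shift[of b a "c * d"]
    by (simp add: mult_single pderiv_var_single lookup_add mult.assoc mult.left_commute[of c]
        add.commute distrib_right single_add)
qed

text \<open>Both sides are bilinear in \<open>p\<close> and \<open>q\<close>, so two monomials
  suffice.\<close>

lemma pderiv_var_mult: "pderiv_var i (p * q) = pderiv_var i p * q + p * pderiv_var i q"
proof -
  let ?s = "\<lambda>p m. Poly_Mapping.single m (Poly_Mapping.lookup p m)"
  have "pderiv_var i ((\<Sum>m\<in>Poly_Mapping.keys p. ?s p m) * (\<Sum>k\<in>Poly_Mapping.keys q. ?s q k))
    = pderiv_var i (\<Sum>m\<in>Poly_Mapping.keys p. ?s p m) * (\<Sum>k\<in>Poly_Mapping.keys q. ?s q k)
      + (\<Sum>m\<in>Poly_Mapping.keys p. ?s p m) * pderiv_var i (\<Sum>k\<in>Poly_Mapping.keys q. ?s q k)"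
    by (simp only: sum_product pderiv_var_sum pderiv_var_mult_single sum.distrib)
  then show ?thesis
    by (simp only: poly_mapping_sum_single[symmetric])
qed

lemma pderiv_var_power: "pderiv_var i (f ^ Suc d) = of_nat (Suc d) * f ^ d * pderiv_var i f"
  by (induction d) (simp_all add: pderiv_var_mult algebra_simps)

lemma pderiv_var_low:
  assumes "p \<in> low S D"
  shows "pderiv_var i p \<in> low S (D - 1)"
  unfolding low_def
proof safe
  fix m assume "m \<in> Poly_Mapping.keys (pderiv_var i p)"
  then have "m + Poly_Mapping.single i 1 \<in> Poly_Mapping.keys p"
    by (auto simp: in_keys_iff pderiv_var.rep_eq)
  with assms have "m + Poly_Mapping.single i 1 \<in> exps S D"
    by (auto simp: low_def)
  then show "m \<in> exps S (D - 1)"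
    by (auto simp: exps_def mono_deg_add mono_deg_single keys_add_nat)
qed

text \<open>At \<open>D = 0\<close> the bound \<open>D - 1\<close> of \<open>pderiv_var_low\<close>
  truncates and gains nothing; vanishing is the substitute.\<close>

lemma pderiv_var_low_0:
  assumes "p \<in> low S 0"
  shows "pderiv_var i p = 0"
proof (rule poly_mapping_eqI)
  fix m :: "nat \<Rightarrow>\<^sub>0 nat"
  have "m + Poly_Mapping.single i 1 \<noteq> 0"
  proof
    assume "m + Poly_Mapping.single i 1 = 0"
    then have "Poly_Mapping.lookup (m + Poly_Mapping.single i 1) i = 0" by simp
    then show False by (simp add: lookup_add)
  qed
  with assms have "m + Poly_Mapping.single i 1 \<notin> Poly_Mapping.keys p"
    by (auto simp: low_def exps_0)
  then show "Poly_Mapping.lookup (pderiv_var i p) m = Poly_Mapping.lookup 0 m"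
    by (simp add: pderiv_var.rep_eq in_keys_iff)
qed

lemma foldr_pderiv_var_sum_list:
  "foldr pderiv_var is (\<Sum>x\<leftarrow>xs. f x) = (\<Sum>x\<leftarrow>xs. foldr pderiv_var is (f x))"
  by (induction "is") (simp_all add: pderiv_var_sum_list)

text \<open>The truncated exponent \<open>d - length is\<close> is harmless: once it reaches 0, the power is 1 and only
  the cofactor is differentiated.\<close>

lemma foldr_pderiv_var_power:
  fixes f :: "'a::comm_semiring_1 mpoly"
  assumes f: "f \<in> low S t" and "t \<ge> 1"
  shows "\<exists>h \<in> low S (length is * (t - 1)). foldr pderiv_var is (f ^ d) = f ^ (d - length is) * h"
proof (induction "is")
  case Nil
  show ?case using low_of_nat[of 1 S] by (auto intro!: bexI[of _ 1])
next
  case (Cons i "is")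
  let ?k = "length is"
  obtain h where h: "h \<in> low S (?k * (t - 1))" "foldr pderiv_var is (f ^ d) = f ^ (d - ?k) * h"
    using Cons.IH by blast
  have h': "pderiv_var i h \<in> low S (?k * (t - 1))"
    using pderiv_var_low[OF h(1)] low_mono[of "?k * (t - 1) - 1" "?k * (t - 1)"] by fastforce
  show ?case
  proof (cases "d - ?k")
    case 0
    then show ?thesis
      using h h' low_mono[of "?k * (t - 1)" "t - 1 + ?k * (t - 1)" S]
      by (auto intro!: bexI[of _ "pderiv_var i h"])
  next
    case (Suc e)
    \<comment> \<open>The cofactor left when \<open>f ^ e\<close> is taken out of the derivative of
      \<open>f ^ Suc e * h\<close>.\<close>
    define h2 where "h2 = of_nat (Suc e) * pderiv_var i f * h + f * pderiv_var i h"
    have "f * pderiv_var i h \<in> low S (t - 1 + ?k * (t - 1))"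
    \<comment> \<open>Multiplication by \<open>f\<close> costs \<open>t\<close> degrees, but only
      \<open>t - 1\<close> are available. Differentiating \<open>h\<close> saves the missing one,
      unless \<open>h\<close> is constant, and then the term is zero.\<close>
    proof (cases "?k * (t - 1) = 0")
      case True
      then have "pderiv_var i h = 0"
        using h(1) pderiv_var_low_0 by metis
      then show ?thesis by (simp add: low_def)
    next
      case False
      have "f * pderiv_var i h \<in> low S (t + (?k * (t - 1) - 1))"
        by (intro low_mult f pderiv_var_low h)
      moreover have "t + (?k * (t - 1) - 1) = t - 1 + ?k * (t - 1)"
        using False \<open>t \<ge> 1\<close> by linarith
      ultimately show ?thesis by (simp only:)
    qed
    moreover have "of_nat (Suc e) * pderiv_var i f * h \<in> low S (0 + (t - 1) + ?k * (t - 1))"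
      by (intro low_mult low_of_nat pderiv_var_low f h)
    ultimately have "h2 \<in> low S (length (i # is) * (t - 1))"
      unfolding h2_def by (intro low_add) simp_all
    moreover have "foldr pderiv_var (i # is) (f ^ d) = f ^ (d - length (i # is)) * h2"
    proof -
      have "d - length (i # is) = e" using Suc by simp
      moreover have "pderiv_var i (f ^ Suc e * h) = f ^ e * h2"
        unfolding h2_def pderiv_var_mult pderiv_var_power by (simp add: algebra_simps del: of_nat_Suc)
      ultimately show ?thesis by (simp only: foldr.simps o_apply h(2) Suc)
    qed
    ultimately show ?thesis by (rule bexI[rotated])
  qed
qed

text \<open>No variable is differentiated twice, so each contributes one factor, unaffected by the
  other derivatives.\<close>

lemma lookup_foldr_pderiv_var:
  assumes "distinct is"
  shows "Poly_Mapping.lookup (foldr pderiv_var is p) m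
    = (\<Prod>i\<in>set is. of_nat (Suc (Poly_Mapping.lookup m i))) * Poly_Mapping.lookup p (m + set_exp (set is))"
  using assms
proof (induction "is" arbitrary: m)
  case (Cons i "is")
  have "Poly_Mapping.lookup (m + Poly_Mapping.single i 1) j = Poly_Mapping.lookup m j" if "j \<in> set is" for j
    using Cons.prems that by (auto simp: lookup_add lookup_single when_def)
  moreover have "m + Poly_Mapping.single i 1 + set_exp (set is) = m + set_exp (set (i # is))"
    using Cons.prems by (simp add: set_exp_def ac_simps)
  ultimately show ?case
    using Cons by (simp add: pderiv_var.rep_eq mult.assoc del: of_nat_Suc)
qed (simp add: set_exp_def)

subsection \<open>Linear independence of leading monomials\<close>

interpretation mpoly: vector_space "\<lambda>(c :: 'a::field) p :: 'a mpoly. Poly_Mapping.single 0 c * p"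
  by unfold_locales (simp_all add: algebra_simps single_add mult_single)

lemma lookup_scale: "Poly_Mapping.lookup (Poly_Mapping.single 0 (c::'a::field) * p) m = c * Poly_Mapping.lookup (p :: 'a mpoly) m"
  by (simp add: mult_map_scale_conv_mult[symmetric] Poly_Mapping.map.rep_eq when_def)

text \<open>In a vanishing combination, take the vector of largest leading monomial among those with
  nonzero coefficient: no other one can cancel that monomial.\<close>

lemma independent_leading_monomials:
  fixes V :: "'a::field mpoly set"
  assumes nz: "0 \<notin> V" and inj: "inj_on (\<lambda>p. Max (Poly_Mapping.keys p)) V"
  shows "mpoly.independent V"
  unfolding mpoly.independent_explicit_finite_subsets
proof (intro allI impI, rule ccontr)
  fix S u
  assume S: "S \<subseteq> V" "finite S" and sum0: "(\<Sum>v\<in>S. Poly_Mapping.single 0 (u v) * v) = 0"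
    and nonzero: "\<not> (\<forall>v\<in>S. u v = 0)"
  let ?lm = "\<lambda>p :: 'a mpoly. Max (Poly_Mapping.keys p)"
  define Z where "Z = {v \<in> S. u v \<noteq> 0}"
  have Z: "finite Z" "Z \<noteq> {}"
    using S nonzero by (auto simp: Z_def)
  obtain w where w: "w \<in> Z" "?lm w = Max (?lm ` Z)"
    using Max_in[of "?lm ` Z"] Z by (metis (no_types, lifting) finite_imageI image_iff image_is_empty)
  have "Poly_Mapping.lookup (Poly_Mapping.single 0 (u v) * v) (?lm w) = 0" if "v \<in> S - {w}" for v
  proof (cases "u v = 0")
    case False
    then have "v \<in> Z" using that by (simp add: Z_def)
    then have "?lm v \<le> ?lm w" using w Z by simp
    moreover have "?lm v \<noteq> ?lm w"
      using inj_onD[OF inj, of v w] that S w(1) by (auto simp: Z_def)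
    ultimately have "?lm w \<notin> Poly_Mapping.keys v"
      using Max_ge[OF finite_keys, of "?lm w" v] by (blast intro: antisym)
    then show ?thesis by (simp add: lookup_scale in_keys_iff)
  qed simp
  then have "Poly_Mapping.lookup (\<Sum>v\<in>S. Poly_Mapping.single 0 (u v) * v) (?lm w)
      = Poly_Mapping.lookup (Poly_Mapping.single 0 (u w) * w) (?lm w)"
    using w(1) S by (simp add: lookup_add lookup_sum sum.remove[of S w] Z_def)
  moreover have "?lm w \<in> Poly_Mapping.keys w"
    using w S nz by (intro Max_in) (auto simp: Z_def)
  ultimately show False
    using sum0 w by (simp add: lookup_scale in_keys_iff Z_def)
qed

text \<open>Independent vectors are no more numerous than a spanning set. Injectivity of
  \<open>lm\<close> forces injectivity of \<open>F\<close>, so counting indices counts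
  vectors.\<close>

lemma card_le_of_leading_monomials:
  fixes F :: "'i \<Rightarrow> 'a::field mpoly"
  assumes "finite T" and span: "\<And>e. e \<in> I \<Longrightarrow> F e \<in> mpoly.span T"
    and lm: "\<And>e. e \<in> I \<Longrightarrow> lm e \<in> Poly_Mapping.keys (F e)"
      "\<And>e m. e \<in> I \<Longrightarrow> m \<in> Poly_Mapping.keys (F e) \<Longrightarrow> m \<le> lm e"
    and inj: "inj_on lm I"
  shows "card I \<le> card T"
proof -
  have Max: "Max (Poly_Mapping.keys (F e)) = lm e" if "e \<in> I" for e
    using lm that by (intro Max_eqI) auto
  have "mpoly.independent (F ` I)"
  proof (rule independent_leading_monomials)
    show "0 \<notin> F ` I" using lm(1) by force
    show "inj_on (\<lambda>p. Max (Poly_Mapping.keys p)) (F ` I)"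
      using inj Max by (auto simp: inj_on_def)
  qed
  then have "card (F ` I) \<le> card T"
    using mpoly.independent_span_bound[OF \<open>finite T\<close>] span by blast
  moreover have "inj_on F I"
    using inj Max by (metis inj_on_def)
  ultimately show ?thesis by (simp add: card_image)
qed

text \<open>Expanding \<open>h\<close> into monomials makes the number of generators depend only on
  the degree bound.\<close>

lemma low_mult_in_span:
  fixes p h :: "'a::field mpoly"
  assumes "h \<in> low S D"
  shows "p * h \<in> mpoly.span ((\<lambda>m. p * Poly_Mapping.single m 1) ` exps S D)"
proof -
  have "p * h = (\<Sum>m\<in>Poly_Mapping.keys h. Poly_Mapping.single 0 (Poly_Mapping.lookup h m) * (p * Poly_Mapping.single m 1))"
    by (subst poly_mapping_sum_single[of h])
      (simp add: sum_distrib_left mult.left_commute[of _ p] mult_single)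
  also have "\<dots> \<in> mpoly.span ((\<lambda>m. p * Poly_Mapping.single m 1) ` exps S D)"
    using assms by (intro mpoly.span_sum mpoly.span_scale mpoly.span_base) (auto simp: low_def)
  finally show ?thesis .
qed

subsection \<open>Counting exponents\<close>

text \<open>Each such exponent is uniquely \<open>1\<^sub>A + c\<close> with \<open>A\<close> its support, and \<open>c\<close> supported in \<open>A\<close>.\<close>

lemma finite_card_exact_support:
  fixes r L :: nat
  assumes S: "finite S"
  defines "E \<equiv> {m. Poly_Mapping.keys m \<subseteq> S \<and> card (Poly_Mapping.keys m) = r \<and> mono_deg m \<le> r + L}"
  shows "card E = (card S choose r) * ((r + L) choose L)"
proof -
  let ?P = "Sigma {A. A \<subseteq> S \<and> card A = r} (\<lambda>A. exps A L)"
  have fin: "finite A" if "A \<subseteq> S" for A using S that finite_subset by blast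
  have deg: "mono_deg (set_exp A) = card A" if "A \<subseteq> S" for A
    using fin[OF that] by (simp add: mono_deg_def keys_set_exp lookup_set_exp)
  have keys: "Poly_Mapping.keys (set_exp A + c) = A" if "A \<subseteq> S" "c \<in> exps A L" for A c
    using fin[OF that(1)] that by (auto simp: keys_add_nat keys_set_exp exps_def)
  have inj: "inj_on (\<lambda>(A, c). set_exp A + c) ?P"
  proof (rule inj_onI, clarify)
    fix A c A' c'
    assume *: "A \<subseteq> S" "A' \<subseteq> S" "c \<in> exps A L" "c' \<in> exps A' L"
      and eq: "set_exp A + c = set_exp A' + c'"
    have "A = A'" using keys[of A c] keys[of A' c'] * eq by simp
    then show "A = A' \<and> c = c'" using eq by simp
  qed
  have image: "(\<lambda>(A, c). set_exp A + c) ` ?P = E"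
  proof (intro equalityI subsetI)
    fix m assume m: "m \<in> E"
    let ?A = "Poly_Mapping.keys m"
    have A: "?A \<subseteq> S" using m by (simp add: E_def)
    have eq: "m = set_exp ?A + (m - set_exp ?A)"
      by (intro poly_mapping_eqI) (auto simp: lookup_add lookup_minus lookup_set_exp in_keys_iff)
    have "Poly_Mapping.keys (m - set_exp ?A) \<subseteq> ?A"
      by (auto simp: in_keys_iff lookup_minus)
    moreover have "mono_deg m = card ?A + mono_deg (m - set_exp ?A)"
      using arg_cong[OF eq, of mono_deg] by (simp only: mono_deg_add deg[OF A])
    ultimately have "(?A, m - set_exp ?A) \<in> ?P"
      using m by (auto simp: E_def exps_def)
    then show "m \<in> (\<lambda>(A, c). set_exp A + c) ` ?P"
      using eq by force
  qed (auto simp: E_def keys mono_deg_add deg, auto simp: exps_def)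
  have "card E = card ?P"
    unfolding image[symmetric] by (rule card_image[OF inj])
  also have "\<dots> = (\<Sum>A | A \<subseteq> S \<and> card A = r. card (exps A L))"
    using S fin by (intro card_SigmaI) (auto simp: finite_card_exps)
  also have "\<dots> = (\<Sum>A | A \<subseteq> S \<and> card A = r. (r + L) choose L)"
    using fin by (intro sum.cong) (auto simp: finite_card_exps)
  also have "\<dots> = (card S choose r) * ((r + L) choose L)"
    using n_subsets[OF S] by simp
  finally show ?thesis .
qed

text \<open>Raising \<open>a + j\<close> by one multiplies the binomial by
  \<open>(a + j + 1 + b) / (a + j + 1)\<close>, which is at most \<open>(a + b) / a\<close>;
  denominators are cleared to stay in the naturals.\<close>

lemma binomial_add_mult_power_le:
  "((a + j + b) choose b) * a ^ j \<le> ((a + b) choose b) * (a + b) ^ j"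
proof (induction j)
  case (Suc j)
  have absorb: "Suc (a + j) * ((a + Suc j + b) choose b) = (a + Suc j + b) * ((a + j + b) choose b)"
    using Suc_times_binomial_add[of "a + j" b]
      binomial_absorb_comp[of "a + Suc j + b" b] by (simp add: ac_simps)
  have "Suc (a + j) * (((a + Suc j + b) choose b) * a ^ Suc j)
      = (Suc (a + j) * ((a + Suc j + b) choose b)) * (a * a ^ j)"
    by (simp only: power_Suc mult.assoc)
  also have "\<dots> = ((a + Suc j + b) * a) * (((a + j + b) choose b) * a ^ j)"
    unfolding absorb by (simp only: ac_simps)
  also have "\<dots> \<le> (Suc (a + j) * (a + b)) * (((a + b) choose b) * (a + b) ^ j)"
    by (rule mult_le_mono[OF _ Suc]) (simp add: algebra_simps)
  finally have "Suc (a + j) * (((a + Suc j + b) choose b) * a ^ Suc j)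
      \<le> Suc (a + j) * (((a + b) choose b) * (a + b) ^ Suc j)"
    by (simp only: power_Suc ac_simps)
  then show ?case by (simp only: mult_le_cancel1)
qed simp

text \<open>With \<open>m = n - k\<close>, \<open>L = n t\<close>, \<open>M = k (t - 1)\<close>, the ratio of the two sides is at most
  \<open>2\<^sup>k (1 + m / L)\<^sup>M ((m + L + M) / m)\<^sup>k (k / n)\<^sup>k\<close>, and the factors are bounded by
  \<open>2\<^sup>k\<close>, \<open>3\<^sup>k\<close>, \<open>(3 t)\<^sup>k\<close> and \<open>(1 / (20 t))\<^sup>k\<close>.\<close>

lemma binomial_ratio_bound:
  fixes n k t :: nat
  assumes k: "k \<ge> 1" and t: "t \<ge> 1" and n: "20 * t * k \<le> n"
  shows "2 ^ k * ((n + (n * t + k * (t - 1))) choose (n * t + k * (t - 1)))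
    \<le> (n choose (n - k)) * (((n - k) + n * t) choose (n * t))"
proof -
  define m L M where "m = n - k" and "L = n * t" and "M = k * (t - 1)"
  have "20 * k \<le> 20 * t * k" using t by simp
  then have kn: "20 * k \<le> n" using n by linarith
  then have n_eq: "n = m + k" and m: "m > 0" "19 * n \<le> 20 * m"
    using k by (auto simp: m_def)
  have L: "L > 0" using k kn t by (simp add: L_def)
  let ?X = "real ((n + (L + M)) choose (L + M))"
  let ?Y = "real ((m + (L + M)) choose m)"
  let ?Z = "real ((m + L) choose L)"
  have 1: "?X * real m ^ k \<le> ?Y * real (m + L + M) ^ k"
    using of_nat_mono[OF binomial_add_mult_power_le[of m k "L + M"], where ?'a = real]
      binomial_symmetric[of m "m + (L + M)"] by (simp add: n_eq add.assoc)
  have 2: "?Y * real L ^ M \<le> ?Z * real (m + L) ^ M"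
    using of_nat_mono[OF binomial_add_mult_power_le[of L M m], where ?'a = real]
      binomial_symmetric[of L "m + L"] by (simp add: add.commute add.left_commute)
  have 3: "(real n / real k) ^ k \<le> real (n choose m)"
    using binomial_ge_n_over_k_pow_k[of k n, where ?'a = real] kn binomial_symmetric[of k n]
    by (simp add: m_def)
  \<comment> \<open>\<open>18 * t\<close> is the product of the losses 2, 3 and \<open>3 * t\<close>
    incurred per unit of \<open>k\<close>.\<close>
  have t18: "18 * real t \<le> real n / real k"
  proof -
    have "real (20 * t * k) \<le> real n" using n by (rule of_nat_mono)
    then show ?thesis using k by (simp add: field_simps)
  qed
  have exp3: "exp (real M / real t) \<le> 3 ^ k"
  proof -
    have "exp (real M / real t) \<le> exp (real k)"
      using t by (simp add: M_def field_simps)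
    also have "\<dots> \<le> 3 ^ k"
      using power_mono[of "exp 1 :: real" 3 k] exp_le exp_of_nat_mult[of k "1 :: real"] by simp
    finally show ?thesis .
  qed
  \<comment> \<open>As \<open>m \<le> n\<close> and \<open>L = n * t\<close>, the ratio of the bases
    is at most \<open>1 + 1 / t \<le> exp (1 / t)\<close>; its \<open>M\<close>-th power is at most
    \<open>exp k\<close> because \<open>M \<le> k * t\<close>.\<close>
  have "real (m + L) ^ M \<le> 3 ^ k * real L ^ M"
  proof -
    have "real (m + L) \<le> real L * (1 + 1 / real t)"
      using t by (simp add: L_def m_def field_simps)
    also have "\<dots> \<le> real L * exp (1 / real t)"
      by (intro mult_left_mono exp_ge_add_one_self) simp
    finally have "real (m + L) ^ M \<le> (real L * exp (1 / real t)) ^ M"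
      by (intro power_mono) auto
    also have "\<dots> = real L ^ M * exp (real M / real t)"
      by (simp add: power_mult_distrib exp_of_nat_mult[symmetric])
    also have "\<dots> \<le> real L ^ M * 3 ^ k"
      by (intro mult_left_mono exp3) simp
    finally show ?thesis by (simp add: mult.commute)
  qed
  then have "?Y * real L ^ M \<le> ?Z * (3 ^ k * real L ^ M)"
    using 2 by (meson mult_left_mono of_nat_0_le_iff order_trans)
  then have 4: "?Y \<le> ?Z * 3 ^ k"
    using L by (simp flip: mult.assoc)
  have "real (m + L + M) \<le> 3 * real t * real m"
  proof -
    have "M \<le> t * k" by (simp add: M_def)
    then have "20 * M \<le> n" using n by linarith
    moreover have "m \<le> n" by (simp add: m_def)
    moreover have "n \<le> L" using t by (simp add: L_def)
    \<comment> \<open>Here 41 = 20 + 20 + 1, since \<open>m \<le> L\<close> and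
      \<open>20 * M \<le> L\<close>. With \<open>19 * L \<le> 20 * q\<close> below, the total is at
      most 41/19 of \<open>q\<close>, hence below the factor 3.\<close>
    ultimately have "20 * m + 20 * L + 20 * M \<le> 41 * L"
      by linarith
    moreover define q where "q = m * t"
    moreover have "19 * L \<le> 20 * q"
      using mult_right_mono[OF m(2), of t] by (simp add: L_def q_def ac_simps)
    ultimately have "m + L + M \<le> 3 * q"
      by linarith
    then have "real (m + L + M) \<le> real (3 * q)" by (rule of_nat_mono)
    then show ?thesis by (simp add: q_def ac_simps)
  qed
  then have "real (m + L + M) ^ k \<le> (3 * real t * real m) ^ k"
    by (intro power_mono) auto
  then have "?X * real m ^ k \<le> (?Z * 3 ^ k) * (3 * real t * real m) ^ k"
    by (intro order_trans[OF 1] mult_mono 4) auto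
  also have "(?Z * 3 ^ k) * (3 * real t * real m) ^ k = (?Z * (9 * real t) ^ k) * real m ^ k"
    using power_mult_distrib[of 3 "3 :: real" k] by (simp add: power_mult_distrib)
  finally have "?X * real m ^ k \<le> (?Z * (9 * real t) ^ k) * real m ^ k" .
  then have "?X \<le> ?Z * (9 * real t) ^ k"
    using m by simp
  then have "2 ^ k * ?X \<le> 2 ^ k * (?Z * (9 * real t) ^ k)"
    by (intro mult_left_mono) auto
  also have "\<dots> = ?Z * (18 * real t) ^ k"
    using power_mult_distrib[of 2 "9 * real t" k, symmetric] by simp
  also have "\<dots> \<le> ?Z * (real n / real k) ^ k"
    using t18 by (intro mult_left_mono power_mono) auto
  also have "\<dots> \<le> ?Z * real (n choose m)"
    by (intro mult_left_mono 3) simp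
  finally have "real (2 ^ k * ((n + (L + M)) choose (L + M))) \<le> real ((n choose m) * ((m + L) choose L))"
    by (simp add: ac_simps)
  then show ?thesis unfolding m_def L_def M_def of_nat_le_iff by simp
qed

subsection \<open>The lower bound\<close>

text \<open>The rate 2/5 works because \<open>exp 2 \<le> 9 \<le> 2 ^ 5\<close>.\<close>

lemma exp_le_2_power:
  assumes "x \<le> real k * 2 / 5"
  shows "exp x \<le> 2 ^ k"
proof -
  have "exp (2 / 5 :: real) ^ 5 = exp 1 ^ 2"
    by (simp flip: exp_of_nat_mult)
  also have "\<dots> \<le> (3 :: real) ^ 2"
    by (intro power_mono exp_le) simp
  also have "\<dots> \<le> 2 ^ 5" by simp
  finally have "exp (2 / 5 :: real) \<le> 2"
    using power_mono_iff[of "exp (2 / 5)" "2 :: real" 5] by simp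
  then have base: "exp (2 / 5 :: real) ^ k \<le> 2 ^ k"
    by (intro power_mono) auto
  have "exp x \<le> exp (real k * (2 / 5))"
    using assms by simp
  also have "\<dots> = exp (2 / 5) ^ k"
    by (rule exp_of_nat_mult)
  finally show ?thesis
    using base by (rule order_trans)
qed

lemma length_le_sum_list_Suc: "length \<Phi> \<le> (\<Sum>(f, d)\<leftarrow>\<Phi>. d + 1)"
  by (induction \<Phi>) auto

lemma length_le_formula_size: "((n + t) choose t) * length \<Phi> \<le> formula_size n t \<Phi>"
  unfolding formula_size_def by (intro mult_left_mono length_le_sum_list_Suc) simp

text \<open>The left side counts leading monomials of shifted derivatives, the right side generators
  of a space containing them. \<open>full\<close> and \<open>char\<close> let the leading monomial
  survive differentiation.\<close>

lemma exact_support_le_length: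
  fixes p :: "'a::field mpoly"
  assumes t: "t \<ge> 1" and k: "k \<le> n"
    and \<Phi>: "power_sum_formula n t \<Phi>" and p: "formula_poly \<Phi> = p" "p \<noteq> 0"
    and full: "\<And>m i. m \<in> Poly_Mapping.keys p \<Longrightarrow> i \<in> {1..n} \<Longrightarrow> Poly_Mapping.lookup m i \<ge> 1"
    and char: "CHAR('a) = 0 \<or> total_degree p < CHAR('a)"
  shows "(n choose (n - k)) * ((n - k + L) choose L)
    \<le> length \<Phi> * ((n + (L + k * (t - 1))) choose (L + k * (t - 1)))"
proof -
  \<comment> \<open>\<open>e\<close> encodes the shift \<open>x^(c e)\<close> of the derivative along the complement of the support of \<open>e\<close>.
    Its leading exponent is \<open>A - 1 + e\<close>, so distinct \<open>e\<close> give distinct leading exponents.\<close>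
  define E where "E = {m. Poly_Mapping.keys m \<subseteq> {1..n} \<and> card (Poly_Mapping.keys m) = n - k
    \<and> mono_deg m \<le> n - k + L}"
  define D where "D = L + k * (t - 1)"
  \<comment> \<open>All derivatives taken have the same order \<open>k\<close>, so the power
    \<open>f ^ (d - k)\<close> is common to them and one family of generators per summand serves
    every \<open>e\<close>.\<close>
  define T where "T = (\<Union>(f, d)\<in>set \<Phi>. (\<lambda>m. f ^ (d - k) * Poly_Mapping.single m (1::'a)) ` exps {1..n} D)"
  define bs where "bs e = sorted_list_of_set ({1..n} - Poly_Mapping.keys e)" for e :: "nat \<Rightarrow>\<^sub>0 nat"
  define c where "c e = e - set_exp (Poly_Mapping.keys e)" for e :: "nat \<Rightarrow>\<^sub>0 nat"
  define F where "F e = Poly_Mapping.single (c e) 1 * foldr pderiv_var (bs e) p" for e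
  define A where "A = Max (Poly_Mapping.keys p)"
  define A' where "A' = A - set_exp {1..n}"
  have A: "A \<in> Poly_Mapping.keys p" and A_max: "\<And>m. m \<in> Poly_Mapping.keys p \<Longrightarrow> m \<le> A"
    using p(2) by (auto simp: A_def)
  have A_eq: "A = A' + set_exp {1..n}"
    using full[OF A] unfolding A'_def
    by (intro poly_mapping_eqI) (simp add: lookup_add lookup_minus lookup_set_exp)
  have bs: "distinct (bs e)" "set (bs e) = {1..n} - Poly_Mapping.keys e" for e
    by (simp_all add: bs_def)
  have length_bs: "length (bs e) = k" if "e \<in> E" for e
  proof -
    have "length (bs e) = card ({1..n} - Poly_Mapping.keys e)" by (simp add: bs_def)
    also have "\<dots> = k" using that k by (subst card_Diff_subset) (auto simp: E_def)
    finally show ?thesis .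
  qed
  have c_eq: "e = c e + set_exp (Poly_Mapping.keys e)" for e
    unfolding c_def
    by (intro poly_mapping_eqI) (auto simp: lookup_add lookup_minus lookup_set_exp in_keys_iff)
  have c_exps: "c e \<in> exps {1..n} L" if "e \<in> E" for e
  proof -
    have "mono_deg (set_exp (Poly_Mapping.keys e)) = card (Poly_Mapping.keys e)"
      by (simp add: mono_deg_def keys_set_exp lookup_set_exp)
    then have "mono_deg e = mono_deg (c e) + (n - k)"
      using arg_cong[OF c_eq[of e], of mono_deg] that by (simp add: mono_deg_add E_def)
    moreover have "Poly_Mapping.keys (c e) \<subseteq> Poly_Mapping.keys e"
      by (auto simp: c_def in_keys_iff lookup_minus)
    ultimately show ?thesis using that by (auto simp: E_def exps_def)
  qed
  have split: "set_exp (set (bs e)) + set_exp (Poly_Mapping.keys e) = set_exp {1..n}" if "e \<in> E" for e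
    using that unfolding bs
    by (intro poly_mapping_eqI) (auto simp: lookup_add lookup_set_exp E_def)

  have span: "F e \<in> mpoly.span T" if e: "e \<in> E" for e
  proof -
    have "F e = (\<Sum>(f, d)\<leftarrow>\<Phi>. Poly_Mapping.single (c e) 1 * foldr pderiv_var (bs e) (f ^ d))"
      unfolding F_def p(1)[symmetric] formula_poly_def
      by (simp add: foldr_pderiv_var_sum_list sum_list_const_mult[symmetric] case_prod_unfold)
    also have "\<dots> \<in> mpoly.span T"
    proof -
      have "Poly_Mapping.single (c e) 1 * foldr pderiv_var (bs e) (f ^ d) \<in> mpoly.span T"
        if fd: "(f, d) \<in> set \<Phi>" for f d
      proof -
        have "f \<in> low {1..n} t"
          using \<Phi> fd mono_deg_le_total_degree[of _ f]
          by (fastforce simp: power_sum_formula_def low_def exps_def poly_ring_def)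
        then obtain h where h: "h \<in> low {1..n} (k * (t - 1))"
          "foldr pderiv_var (bs e) (f ^ d) = f ^ (d - k) * h"
          using foldr_pderiv_var_power[of f "{1..n}" t "bs e" d] t length_bs[OF e] by auto
        have "Poly_Mapping.single (c e) 1 * h \<in> low {1..n} D"
          unfolding D_def by (intro low_mult low_monomial c_exps e h)
        then have "f ^ (d - k) * (Poly_Mapping.single (c e) 1 * h)
            \<in> mpoly.span ((\<lambda>m. f ^ (d - k) * Poly_Mapping.single m 1) ` exps {1..n} D)"
          by (rule low_mult_in_span)
        also have "\<dots> \<subseteq> mpoly.span T"
          using fd by (intro mpoly.span_mono) (force simp: T_def)
        finally have "f ^ (d - k) * (Poly_Mapping.single (c e) 1 * h) \<in> mpoly.span T" .
        then show ?thesis by (simp add: h(2) mult.left_commute)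
      qed
      then show ?thesis
        by (induction \<Phi>) (auto intro: mpoly.span_add mpoly.span_zero)
    qed
    finally show ?thesis .
  qed

  have keys_F: "e + A' \<in> Poly_Mapping.keys (F e)"
    and F_max: "\<And>m. m \<in> Poly_Mapping.keys (F e) \<Longrightarrow> m \<le> e + A'" if e: "e \<in> E" for e
  proof -
    \<comment> \<open>The leading exponent of the derivative: by \<open>split\<close>, removing the
      differentiated variables from \<open>A\<close> leaves \<open>A'\<close> plus the support of
      \<open>e\<close>.\<close>
    define \<mu> where "\<mu> = A' + set_exp (Poly_Mapping.keys e)"
    have lm: "e + A' = c e + \<mu>"
      unfolding \<mu>_def by (subst c_eq) (simp add: ac_simps)
    have \<mu>: "\<mu> + set_exp (set (bs e)) = A"
      unfolding \<mu>_def A_eq split[OF e, symmetric] by (simp only: ac_simps)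
    \<comment> \<open>The factor is an exponent of \<open>A\<close>, positive and at most the total
      degree, hence not divisible by a larger characteristic.\<close>
    have "of_nat (Suc (Poly_Mapping.lookup \<mu> i)) \<noteq> (0 :: 'a)" if "i \<in> set (bs e)" for i
    proof -
      have "Poly_Mapping.lookup A i = Suc (Poly_Mapping.lookup \<mu> i)"
        using that by (simp flip: \<mu> add: lookup_add lookup_set_exp)
      then have "Suc (Poly_Mapping.lookup \<mu> i) \<le> total_degree p"
        using lookup_le_mono_deg[of A i] mono_deg_le_total_degree[OF A] by simp
      then have "\<not> CHAR('a) dvd Suc (Poly_Mapping.lookup \<mu> i)"
        using char by (auto dest: dvd_imp_le)
      then show ?thesis by (simp only: of_nat_eq_0_iff_char_dvd not_False_eq_True)
    qed
    then have "\<mu> \<in> Poly_Mapping.keys (foldr pderiv_var (bs e) p)"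
      using A by (simp add: in_keys_iff lookup_foldr_pderiv_var[OF bs(1)] \<mu> del: of_nat_Suc)
    then show "e + A' \<in> Poly_Mapping.keys (F e)"
      by (simp add: F_def lm in_keys_iff lookup_single_mult_add)
    fix m assume "m \<in> Poly_Mapping.keys (F e)"
    then obtain m' where m': "m = c e + m'" "m' \<in> Poly_Mapping.keys (foldr pderiv_var (bs e) p)"
      using keys_monomial_mult unfolding F_def by blast
    then have "m' + set_exp (set (bs e)) \<in> Poly_Mapping.keys p"
      by (auto simp: in_keys_iff lookup_foldr_pderiv_var[OF bs(1)])
    \<comment> \<open>Differentiation along fixed variables shifts all exponents equally, and the
      order on exponents respects addition and cancellation, so maximality of \<open>A\<close>
      passes to \<open>\<mu>\<close>.\<close>
    then have "m' + set_exp (set (bs e)) \<le> \<mu> + set_exp (set (bs e))"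
      using A_max by (simp add: \<mu>)
    then show "m \<le> e + A'"
      unfolding lm m' by simp
  qed

  have "finite T"
    by (auto simp: T_def finite_card_exps)
  then have "card E \<le> card T"
    using span keys_F F_max by (rule card_le_of_leading_monomials[where lm = "\<lambda>e. e + A'"]) (auto intro: inj_onI)
  also have "card T \<le> (\<Sum>(f, d)\<in>set \<Phi>. card (exps {1..n} D))"
    unfolding T_def case_prod_unfold
    by (intro order_trans[OF card_UN_le] sum_mono card_image_le) (auto simp: finite_card_exps)
  also have "\<dots> \<le> length \<Phi> * card (exps {1..n} D)"
    by (simp add: case_prod_unfold card_length)
  finally show ?thesis
    by (simp add: E_def finite_card_exact_support finite_card_exps D_def)
qed

text \<open>The choice \<open>L = n * t\<close> puts the same positive binomial \<open>?C\<close> on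
  both sides, where it cancels.\<close>

lemma two_power_le_length:
  fixes p :: "'a::field mpoly"
  assumes t: "t \<ge> 1" and k: "k \<ge> 1" "20 * t * k \<le> n"
    and "power_sum_formula n t \<Phi>" and "formula_poly \<Phi> = p" "p \<noteq> 0"
    and "\<And>m i. m \<in> Poly_Mapping.keys p \<Longrightarrow> i \<in> {1..n} \<Longrightarrow> Poly_Mapping.lookup m i \<ge> 1"
    and "CHAR('a) = 0 \<or> total_degree p < CHAR('a)"
  shows "2 ^ k \<le> length \<Phi>"
proof -
  let ?C = "(n + (n * t + k * (t - 1))) choose (n * t + k * (t - 1))"
  have "k \<le> 20 * t * k" using t by simp
  then have "k \<le> n" using k(2) by linarith
  have "2 ^ k * ?C \<le> (n choose (n - k)) * (((n - k) + n * t) choose (n * t))"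
    by (rule binomial_ratio_bound) (use assms in auto)
  also have "\<dots> \<le> length \<Phi> * ?C"
    using assms \<open>k \<le> n\<close> by (intro exact_support_le_length) auto
  finally show ?thesis by simp
qed

theorem corollary6p11:
  fixes n t :: nat
    and g :: "'a::field mpoly"
    and \<Phi> :: "'a power_sum"
  assumes "t \<ge> 1"
    and "g \<in> poly_ring n"
    and "g * (\<Prod>i=1..n. indet i) \<noteq> 0"
    and "CHAR('a) = 0 \<or> total_degree (g * (\<Prod>i=1..n. indet i)) < CHAR('a)"
    and "power_sum_formula n t \<Phi>"
    and "formula_poly \<Phi> = g * (\<Prod>i=1..n. indet i)"
  shows "real (formula_size n t \<Phi>) \<ge> exp (exponent_const * (real n / real t))"
proof -
  let ?p = "g * (\<Prod>i=1..n. indet i)"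
  define k where "k = n div (20 * t)"
  have size: "((n + t) choose t) * length \<Phi> \<le> formula_size n t \<Phi>"
    by (rule length_le_formula_size)
  have "\<Phi> \<noteq> []"
    using assms(3,6) by (auto simp: formula_poly_def)
  then have len: "length \<Phi> \<ge> 1" by (cases \<Phi>) auto
  have pos: "(n + t) choose t \<ge> 1" by (simp add: Suc_le_eq)
  have full: "Poly_Mapping.lookup m i \<ge> 1" if "m \<in> Poly_Mapping.keys ?p" "i \<in> {1..n}" for m i
  proof -
    have "m \<in> (+) (set_exp {1..n}) ` Poly_Mapping.keys g"
      using that(1) keys_monomial_mult[of "set_exp {1..n}" g]
      by (auto simp: prod_indet mult.commute)
    then show ?thesis using that(2) by (auto simp: lookup_add lookup_set_exp)
  qed
  have "n < 20 * t * (k + 1)"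
    using assms(1) dividend_less_times_div[of "20 * t" n] by (simp add: k_def)
  then have "real n \<le> real (20 * t * (k + 1))" by (simp only: of_nat_le_iff)
  \<comment> \<open>The bound \<open>n < 20 * t * (k + 1)\<close> meets the constant 1/100, and
    20/100 = 1/5. For \<open>k \<ge> 1\<close> this is within the rate 2/5 of
    \<open>exp_le_2_power\<close>, as \<open>k + 1 \<le> 2 * k\<close>.\<close>
  then have ratio: "exponent_const * (real n / real t) \<le> real (k + 1) / 5"
    using assms(1) by (simp add: exponent_const_def field_simps)
  consider "n = 0" | "n > 0" "k = 0" | "k \<ge> 1" by linarith
  then show ?thesis
  proof cases
    case 1
    then show ?thesis using mult_mono[OF pos len] size by simp
  next
    case 2
    \<comment> \<open>With \<open>k = 0\<close> derivatives give nothing; the binomial factor of the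
      size alone supplies the required 2.\<close>
    have "2 \<le> Suc n" using 2 by simp
    also have "\<dots> \<le> (n + t) choose n"
      using binomial_right_mono[of "Suc n" "n + t" n] assms(1) by simp
    also have "\<dots> = (n + t) choose t"
      using binomial_symmetric[of n "n + t"] by simp
    finally have "2 * 1 \<le> formula_size n t \<Phi>"
      using len size by (meson mult_le_mono order_trans)
    moreover have "exp (exponent_const * (real n / real t)) \<le> 2 ^ 1"
      using ratio 2 by (intro exp_le_2_power) simp
    ultimately show ?thesis by simp
  next
    case 3
    have "20 * t * k \<le> n" by (simp add: k_def)
    then have "2 ^ k \<le> length \<Phi>"
      using 3 assms full by (intro two_power_le_length[of t k n \<Phi> ?p]) auto
    then have "1 * 2 ^ k \<le> formula_size n t \<Phi>"
      using pos size by (meson mult_le_mono order_trans)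
    then have "2 ^ k \<le> real (formula_size n t \<Phi>)"
      by (metis mult_1 of_nat_le_iff of_nat_numeral of_nat_power)
    moreover have "exp (exponent_const * (real n / real t)) \<le> 2 ^ k"
      using ratio 3 by (intro exp_le_2_power) simp
    ultimately show ?thesis by (rule order_trans[rotated])
  qed
qed

end
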